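(* Let $\sigma_1, \sigma_2, \ldots, \sigma_r$ be distinct permutations in $S_3$. Then $S_n(\sigma_1, \sigma_2, \ldots, \sigma_r)$ is sign-balanced for every integer $n>1$ if and only if $\{\sigma_1, \sigma_2, \ldots, \sigma_r\}\neq\{132, 213, 231, 312\}$ and the set $\{\sigma_1, \sigma_2, \ldots, \sigma_r\}$ is sign-balanced.
   Context: Permutations are written in one-line notation $\pi=\pi_1\pi_2\cdots\pi_n\in S_n$. For $\sigma\in S_k$ and $\pi\in S_n$ with $k\le n$, $\pi$ contains the pattern $\sigma$ if there are indices $1\le i_1<\cdots<i_k\le n$ such that for all $1\le s<t\le k$, $\pi_{i_s}>\pi_{i_t}$ iff $\sigma_s>\sigma_t$; otherwise $\pi$ avoids $\sigma$. $S_n(\sigma_1,\ldots,\sigma_r)$ denotes the set of permutations in $S_n$ avoiding every $\sigma_j$. An inversion of $\pi$ is a pair $i<j$ with $\pi_i>\pi_j$; $\pi$ is even (odd) if its number of inversions is even (odd). A set of permutations is sign-balanced if it contains the same number of even permutations as odd permutations. *)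

theory Defs
  imports "HOL-Combinatorics.Multiset_Permutations"
begin

text \<open>
  A permutation of \<open>{1..n}\<close> is represented by its one-line notation, the list
  \<open>[\<pi>\<^sub>1, \<dots>, \<pi>\<^sub>n]\<close>; positions in the list are counted from 0.
\<close>

definition symm :: "nat \<Rightarrow> nat list set" where
  "symm n = permutations_of_set {1..n}"

text \<open>The function \<open>i\<close> lists the positions \<open>i\<^sub>1 < \<dots> < i\<^sub>k\<close> of an occurrence of \<open>\<sigma>\<close> in \<open>\<pi>\<close>.\<close>

definition contains_pattern :: "nat list \<Rightarrow> nat list \<Rightarrow> bool" where
  "contains_pattern \<pi> \<sigma> \<longleftrightarrow>
     (\<exists>i :: nat \<Rightarrow> nat.
        strict_mono_on {..<length \<sigma>} i \<and>
        (\<forall>s < length \<sigma>. i s < length \<pi>) \<and>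
        (\<forall>s t. s < t \<and> t < length \<sigma> \<longrightarrow> (\<pi> ! i s > \<pi> ! i t \<longleftrightarrow> \<sigma> ! s > \<sigma> ! t)))"

definition avoiders :: "nat \<Rightarrow> nat list set \<Rightarrow> nat list set" where
  "avoiders n \<Sigma> = {\<pi> \<in> symm n. \<forall>\<sigma> \<in> \<Sigma>. \<not> contains_pattern \<pi> \<sigma>}"

definition inversions :: "nat list \<Rightarrow> (nat \<times> nat) set" where
  "inversions \<pi> = {(i, j). i < j \<and> j < length \<pi> \<and> \<pi> ! i > \<pi> ! j}"

definition even_perm :: "nat list \<Rightarrow> bool" where
  "even_perm \<pi> \<longleftrightarrow> even (card (inversions \<pi>))"

definition odd_perm :: "nat list \<Rightarrow> bool" where
  "odd_perm \<pi> \<longleftrightarrow> odd (card (inversions \<pi>))"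

text \<open>Meaningful for finite sets of permutations only, since \<open>card\<close> is 0 on infinite sets.\<close>

definition sign_balanced :: "nat list set \<Rightarrow> bool" where
  "sign_balanced A \<longleftrightarrow> card {\<pi> \<in> A. even_perm \<pi>} = card {\<pi> \<in> A. odd_perm \<pi>}"

end

theory Submission
  imports Defs
begin

text \<open>
  Necessity comes from \<open>n = 3\<close>, where the avoiders are the complement of \<open>\<Sigma>\<close> in the balanced set
  \<open>S\<^sub>3\<close>, and from \<open>n = 4\<close> for the exceptional set, where only the even permutations 1234 and 4321
  survive. For sufficiency, a balanced \<open>\<Sigma>\<close> falls under one of the following cases. If \<open>\<Sigma>\<close> is closed
  under exchanging the last two (or the first two) entries of its patterns, then exchanging the
  last two (first two) entries is a sign-reversing involution on the avoiders. Avoiding 132 and 231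
  means having no peak, which is preserved by exchanging the values 1 and 2; avoiding 213 and 312
  means having no valley, which is preserved by exchanging the values \<open>n - 1\<close> and \<open>n\<close>. Otherwise
  \<open>\<Sigma>\<close> contains 123 and 321, so there are no avoiders for \<open>n \<ge> 5\<close>, and few for \<open>n \<le> 4\<close>.
\<close>

section \<open>Permutations as lists, and parity-reversing involutions\<close>

lemma symm_iff: "\<pi> \<in> symm n \<longleftrightarrow> distinct \<pi> \<and> set \<pi> = {1..n}"
  by (auto simp: symm_def permutations_of_set_def)

lemma length_symm: "\<pi> \<in> symm n \<Longrightarrow> length \<pi> = n"
  using distinct_card[of \<pi>] by (simp add: symm_iff)

lemma finite_symm: "finite (symm n)"
  by (simp add: symm_def)

text \<open>Such an \<open>f\<close> restricts to a bijection from the even to the odd members whose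
  inverse is \<open>f\<close> itself.\<close>

lemma sign_balanced_involution:
  assumes "finite A" and into: "\<And>\<pi>. \<pi> \<in> A \<Longrightarrow> f \<pi> \<in> A"
    and invol: "\<And>\<pi>. \<pi> \<in> A \<Longrightarrow> f (f \<pi>) = \<pi>"
    and parity: "\<And>\<pi>. \<pi> \<in> A \<Longrightarrow> even_perm (f \<pi>) \<longleftrightarrow> \<not> even_perm \<pi>"
  shows "sign_balanced A"
proof -
  have "bij_betw f {\<pi> \<in> A. even_perm \<pi>} {\<pi> \<in> A. odd_perm \<pi>}"
    by (rule bij_betw_byWitness[where f' = f])
      (use into invol parity in \<open>auto simp: odd_perm_def even_perm_def\<close>)
  then show ?thesis
    unfolding sign_balanced_def by (rule bij_betw_same_card)
qed

lemma finite_inversions: "finite (inversions \<pi>)"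
  by (rule finite_subset[of _ "{..<length \<pi>} \<times> {..<length \<pi>}"]) (auto simp: inversions_def)

text \<open>The numbers of inversions differ by exactly one. Removing the designated pair on both
  sides treats alike an exchange that creates this inversion and one that destroys it.\<close>

lemma even_perm_flip_one:
  assumes g: "bij_betw g (inversions \<pi> - {x}) (inversions \<pi>' - {y})"
    and "x \<in> inversions \<pi> \<longleftrightarrow> y \<notin> inversions \<pi>'"
  shows "even_perm \<pi>' \<longleftrightarrow> \<not> even_perm \<pi>"
proof -
  have eq: "card (inversions \<pi> - {x}) = card (inversions \<pi>' - {y})"
    using g by (rule bij_betw_same_card)
  have "even_perm \<rho> \<longleftrightarrow> (even (card (inversions \<rho> - {z})) \<longleftrightarrow> z \<notin> inversions \<rho>)" for \<rho> z
  proof (cases "z \<in> inversions \<rho>")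
    case True
    then show ?thesis
      unfolding even_perm_def using card.remove[OF finite_inversions True] by (metis even_Suc)
  next
    case False
    then show ?thesis
      by (simp add: even_perm_def)
  qed
  from this[of \<pi> x] this[of \<pi>' y] show ?thesis
    using eq assms(2) by metis
qed

section \<open>Exchanges of adjacent entries and of consecutive values\<close>

definition swap_adjacent :: "nat \<Rightarrow> 'a list \<Rightarrow> 'a list" where
  "swap_adjacent p xs = xs[p := xs ! Suc p, Suc p := xs ! p]"

lemma length_swap_adjacent [simp]: "length (swap_adjacent p xs) = length xs"
  by (simp add: swap_adjacent_def)

lemma nth_swap_adjacent:
  "Suc p < length xs \<Longrightarrow> i < length xs \<Longrightarrow>
    swap_adjacent p xs ! i = xs ! transpose p (Suc p) i"
  by (auto simp: swap_adjacent_def transpose_def nth_list_update)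

lemma swap_adjacent_idem:
  "Suc p < length xs \<Longrightarrow> swap_adjacent p (swap_adjacent p xs) = xs"
  by (rule nth_equalityI) (auto simp: swap_adjacent_def nth_list_update)

lemma swap_adjacent_symm:
  "\<pi> \<in> symm n \<Longrightarrow> Suc p < n \<Longrightarrow> swap_adjacent p \<pi> \<in> symm n"
  by (frule length_symm) (simp add: symm_iff swap_adjacent_def)

text \<open>Nothing lies strictly between \<open>p\<close> and \<open>Suc p\<close>, so their
  exchange can reverse the order of that one pair only. This serves for positions and, in the
  equivalence form below, for values.\<close>

lemma transpose_Suc_less:
  assumes "i < j" and "\<not> (i = p \<and> j = Suc p)"
  shows "transpose p (Suc p) i < transpose p (Suc p) j"
  using assms by (auto simp: transpose_def)

lemma transpose_Suc_less_iff:
  assumes "{x, y} \<noteq> {p, Suc p}"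
  shows "transpose p (Suc p) x < transpose p (Suc p) y \<longleftrightarrow> x < y"
proof (cases x y rule: linorder_cases)
  case less
  moreover have "\<not> (x = p \<and> y = Suc p)"
    using assms by auto
  ultimately show ?thesis
    using transpose_Suc_less by blast
next
  case greater
  moreover have "\<not> (y = p \<and> x = Suc p)"
    using assms by auto
  ultimately have "transpose p (Suc p) y < transpose p (Suc p) x"
    using transpose_Suc_less by blast
  then show ?thesis
    using greater by simp
qed simp

lemma transpose_Suc_less_length:
  "Suc p < n \<Longrightarrow> i < n \<Longrightarrow> transpose p (Suc p) i < n"
  by (auto simp: transpose_def)

text \<open>Relabelling positions keeps the order of every pair but \<open>(p, Suc p)\<close>. One
  inclusion is enough for a bijection: applied to the swapped list it yields the other, since
  swapping twice is the identity.\<close>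

lemma inversions_swap_adjacent:
  assumes p: "Suc p < length \<pi>" and x: "x \<in> inversions \<pi> - {(p, Suc p)}"
  shows "map_prod (transpose p (Suc p)) (transpose p (Suc p)) x
    \<in> inversions (swap_adjacent p \<pi>) - {(p, Suc p)}"
proof -
  obtain i j where xij: "x = (i, j)" by fastforce
  then have ij: "i < j" "j < length \<pi>" "\<pi> ! j < \<pi> ! i" "\<not> (i = p \<and> j = Suc p)"
    using x by (auto simp: inversions_def)
  \<comment> \<open>Only \<open>(Suc p, p)\<close> is sent to \<open>(p, Suc p)\<close>, and
    \<open>i < j\<close> excludes it.\<close>
  moreover have "(transpose p (Suc p) i, transpose p (Suc p) j) \<noteq> (p, Suc p)"
    using ij by (auto simp: transpose_def split: if_splits)
  ultimately show ?thesis
    using p transpose_Suc_less[of i j p]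
    by (auto simp: xij inversions_def nth_swap_adjacent transpose_Suc_less_length)
qed

lemma even_perm_swap_adjacent:
  assumes "distinct \<pi>" and p: "Suc p < length \<pi>"
  shows "even_perm (swap_adjacent p \<pi>) \<longleftrightarrow> \<not> even_perm \<pi>"
proof (rule even_perm_flip_one)
  let ?\<tau> = "transpose p (Suc p)"
  show "bij_betw (map_prod ?\<tau> ?\<tau>) (inversions \<pi> - {(p, Suc p)})
      (inversions (swap_adjacent p \<pi>) - {(p, Suc p)})"
  proof (rule bij_betw_byWitness[where f' = "map_prod ?\<tau> ?\<tau>"])
    show "map_prod ?\<tau> ?\<tau> ` (inversions \<pi> - {(p, Suc p)})
        \<subseteq> inversions (swap_adjacent p \<pi>) - {(p, Suc p)}"
      using inversions_swap_adjacent[OF p] by (intro image_subsetI)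
    show "map_prod ?\<tau> ?\<tau> ` (inversions (swap_adjacent p \<pi>) - {(p, Suc p)})
        \<subseteq> inversions \<pi> - {(p, Suc p)}"
      using inversions_swap_adjacent[of p "swap_adjacent p \<pi>"] p
      by (intro image_subsetI) (simp only: swap_adjacent_idem length_swap_adjacent)
  qed auto
  have "\<pi> ! p \<noteq> \<pi> ! Suc p"
    using assms by (simp add: nth_eq_iff_index_eq)
  then show "(p, Suc p) \<in> inversions \<pi> \<longleftrightarrow> (p, Suc p) \<notin> inversions (swap_adjacent p \<pi>)"
    using p by (auto simp: inversions_def nth_swap_adjacent)
qed

text \<open>Positions stay put, and the only comparison that changes is the one between the two
  positions holding \<open>a\<close> and \<open>Suc a\<close>. Off that pair the inversion sets are
  therefore equal, and \<open>id\<close> is the bijection.\<close>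

lemma even_perm_swap_values:
  assumes \<pi>: "\<pi> \<in> symm n" and a: "1 \<le> a" "a < n"
  shows "even_perm (map (transpose a (Suc a)) \<pi>) \<longleftrightarrow> \<not> even_perm \<pi>"
proof -
  let ?\<tau> = "transpose a (Suc a)"
  have dist: "distinct \<pi>"
    using \<pi> by (simp add: symm_iff)
  have "a \<in> set \<pi>" "Suc a \<in> set \<pi>"
    using \<pi> a by (auto simp: symm_iff)
  then obtain k l where kl: "k < length \<pi>" "\<pi> ! k = a" "l < length \<pi>" "\<pi> ! l = Suc a"
    by (metis in_set_conv_nth)
  then have "k \<noteq> l" by auto
  have *: "\<pi> ! i = a \<longleftrightarrow> i = k" "\<pi> ! i = Suc a \<longleftrightarrow> i = l" if "i < length \<pi>" for i
    using dist kl that nth_eq_iff_index_eq by metis+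
  \<comment> \<open>Either of the two values may come first, so the pair of their positions is
    sorted.\<close>
  define x where "x = (min k l, max k l)"
  have less: "?\<tau> (\<pi> ! j) < ?\<tau> (\<pi> ! i) \<longleftrightarrow> \<pi> ! j < \<pi> ! i"
    if "i < j" "j < length \<pi>" "(i, j) \<noteq> x" for i j
  proof (rule transpose_Suc_less_iff, rule notI)
    assume "{\<pi> ! j, \<pi> ! i} = {a, Suc a}"
    then have "i = k \<and> j = l \<or> i = l \<and> j = k"
      using *[of i] *[of j] that by (auto simp: doubleton_eq_iff)
    then have "(i, j) = x"
      using \<open>i < j\<close> by (auto simp: x_def)
    then show False
      using that by simp
  qed
  have "z \<in> inversions (map ?\<tau> \<pi>) - {x} \<longleftrightarrow> z \<in> inversions \<pi> - {x}" for z
    by (cases z) (use less in \<open>auto simp: inversions_def\<close>)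
  then have "inversions (map ?\<tau> \<pi>) - {x} = inversions \<pi> - {x}"
    by blast
  then have "bij_betw id (inversions \<pi> - {x}) (inversions (map ?\<tau> \<pi>) - {x})"
    by simp
  moreover have "x \<in> inversions \<pi> \<longleftrightarrow> x \<notin> inversions (map ?\<tau> \<pi>)"
    using kl \<open>k \<noteq> l\<close> by (auto simp: x_def inversions_def min_def max_def)
  ultimately show ?thesis
    by (rule even_perm_flip_one)
qed

lemma swap_values_symm:
  assumes "\<pi> \<in> symm n" "1 \<le> a" "a < n"
  shows "map (transpose a (Suc a)) \<pi> \<in> symm n"
proof -
  have "transpose a (Suc a) ` {1..n} = {1..n}"
    using assms by (intro transpose_image_eq) auto
  then show ?thesis
    using assms by (simp add: symm_iff distinct_map)
qed

section \<open>Patterns of length three, and exchanges at the ends of a permutation\<close>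

lemma contains_pattern_length_3:
  "contains_pattern \<pi> [a, b, c] \<longleftrightarrow>
    (\<exists>i j k. i < j \<and> j < k \<and> k < length \<pi> \<and>
      (\<pi> ! j < \<pi> ! i \<longleftrightarrow> b < a) \<and> (\<pi> ! k < \<pi> ! i \<longleftrightarrow> c < a) \<and> (\<pi> ! k < \<pi> ! j \<longleftrightarrow> c < b))"
  (is "_ \<longleftrightarrow> ?R")
proof
  assume "contains_pattern \<pi> [a, b, c]"
  then obtain i where i: "strict_mono_on {..<3} i" "\<forall>s<3. i s < length \<pi>"
    and o: "\<And>s t. s < t \<Longrightarrow> t < 3 \<Longrightarrow> \<pi> ! i s > \<pi> ! i t \<longleftrightarrow> [a, b, c] ! s > [a, b, c] ! t"
    by (auto simp: contains_pattern_def numeral_3_eq_3)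
  show ?R
    using i(2) o[of 0 1] o[of 0 2] o[of 1 2] strict_mono_onD[OF i(1), of 0 1]
      strict_mono_onD[OF i(1), of 1 2]
    by (intro exI[of _ "i 0"] exI[of _ "i 1"] exI[of _ "i 2"]) auto
next
  assume ?R
  then obtain i j k where ijk: "i < j" "j < k" "k < length \<pi>" "\<pi> ! j < \<pi> ! i \<longleftrightarrow> b < a"
      "\<pi> ! k < \<pi> ! i \<longleftrightarrow> c < a" "\<pi> ! k < \<pi> ! j \<longleftrightarrow> c < b"
    by blast
  then show "contains_pattern \<pi> [a, b, c]"
    unfolding contains_pattern_def
    \<comment> \<open>Indexing into the list \<open>[i, j, k]\<close> is the required position
      function.\<close>
    by (intro exI[of _ "(!) [i, j, k]"])
      (auto simp: strict_mono_on_def less_Suc_eq numeral_3_eq_3 numeral_2_eq_2)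
qed

lemma symm_3: "symm 3 = {[1,2,3], [1,3,2], [2,1,3], [2,3,1], [3,1,2], [3,2,1]}"
proof -
  \<comment> \<open>With the interval given as a list, \<open>code_simp\<close> can enumerate the
    permutations.\<close>
  have "{1..3} = set [1, 2, 3 :: nat]" by auto
  then show ?thesis
    unfolding symm_def by (simp only:) code_simp
qed

lemma symm_3_E:
  assumes "\<sigma> \<in> symm 3"
  obtains a b c where "\<sigma> = [a, b, c]" "a \<noteq> b" "a \<noteq> c" "b \<noteq> c"
  using assms by (auto simp: symm_3)


text \<open>The occurrence is pulled back along the transposition of positions. Its indices stay
  increasing unless \<open>j\<close> and \<open>k\<close> are the last two positions; these then
  trade places, and so do the last two entries of the pattern.\<close>

lemma contains_pattern_swap_last:
  assumes "contains_pattern (swap_adjacent (n - 2) \<pi>) [a, b, c]" and \<pi>: "\<pi> \<in> symm n"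
    and "b \<noteq> c"
  shows "contains_pattern \<pi> [a, b, c] \<or> contains_pattern \<pi> [a, c, b]"
proof -
  let ?p = "n - 2"
  let ?\<tau> = "transpose ?p (Suc ?p)"
  have len: "length \<pi> = n" using \<pi> by (rule length_symm)
  from assms(1) obtain i j k where ijk: "i < j" "j < k" "k < n"
    and o: "swap_adjacent ?p \<pi> ! j < swap_adjacent ?p \<pi> ! i \<longleftrightarrow> b < a"
      "swap_adjacent ?p \<pi> ! k < swap_adjacent ?p \<pi> ! i \<longleftrightarrow> c < a"
      "swap_adjacent ?p \<pi> ! k < swap_adjacent ?p \<pi> ! j \<longleftrightarrow> c < b"
    by (auto simp: contains_pattern_length_3 len)
  have o: "\<pi> ! ?\<tau> j < \<pi> ! ?\<tau> i \<longleftrightarrow> b < a" "\<pi> ! ?\<tau> k < \<pi> ! ?\<tau> i \<longleftrightarrow> c < a"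
      "\<pi> ! ?\<tau> k < \<pi> ! ?\<tau> j \<longleftrightarrow> c < b"
    using o ijk by (simp_all add: nth_swap_adjacent len)
  show ?thesis
  proof (cases "j = ?p \<and> k = Suc ?p")
    case True
    then have "\<pi> ! j \<noteq> \<pi> ! k"
      using \<pi> ijk by (simp add: symm_iff nth_eq_iff_index_eq len)
    moreover have "?\<tau> i = i" "?\<tau> j = k" "?\<tau> k = j"
      using True ijk by (simp_all add: transpose_def)
    ultimately have "(\<pi> ! j < \<pi> ! i \<longleftrightarrow> c < a) \<and> (\<pi> ! k < \<pi> ! i \<longleftrightarrow> b < a) \<and>
        (\<pi> ! k < \<pi> ! j \<longleftrightarrow> b < c)"
      using o \<open>b \<noteq> c\<close> by simp linarith
    then have "contains_pattern \<pi> [a, c, b]"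
      using ijk unfolding contains_pattern_length_3 len by blast
    then show ?thesis ..
  next
    case False
    \<comment> \<open>Since \<open>k\<close> follows \<open>j\<close>, position \<open>j\<close> is
      not the last one. Three indices also force \<open>n \<ge> 3\<close>, so \<open>n - 2\<close>
      is not truncated.\<close>
    moreover have "\<not> (i = ?p \<and> j = Suc ?p)" "Suc ?p < n"
      using ijk by linarith+
    ultimately have "?\<tau> i < ?\<tau> j" "?\<tau> j < ?\<tau> k" "?\<tau> k < n"
      using ijk by (blast intro: transpose_Suc_less transpose_Suc_less_length)+
    then have "contains_pattern \<pi> [a, b, c]"
      using o unfolding contains_pattern_length_3 len by blast
    then show ?thesis ..
  qed
qed

text \<open>Mirror image of the previous argument: order is lost only if \<open>i\<close> and
  \<open>j\<close> are the first two positions, and then the first two entries of the pattern trade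
  places.\<close>

lemma contains_pattern_swap_first:
  assumes "contains_pattern (swap_adjacent 0 \<pi>) [a, b, c]" and \<pi>: "\<pi> \<in> symm n"
    and "a \<noteq> b"
  shows "contains_pattern \<pi> [a, b, c] \<or> contains_pattern \<pi> [b, a, c]"
proof -
  let ?\<tau> = "transpose 0 (Suc 0)"
  have len: "length \<pi> = n" using \<pi> by (rule length_symm)
  from assms(1) obtain i j k where ijk: "i < j" "j < k" "k < n"
    and o: "swap_adjacent 0 \<pi> ! j < swap_adjacent 0 \<pi> ! i \<longleftrightarrow> b < a"
      "swap_adjacent 0 \<pi> ! k < swap_adjacent 0 \<pi> ! i \<longleftrightarrow> c < a"
      "swap_adjacent 0 \<pi> ! k < swap_adjacent 0 \<pi> ! j \<longleftrightarrow> c < b"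
    by (auto simp: contains_pattern_length_3 len)
  have o: "\<pi> ! ?\<tau> j < \<pi> ! ?\<tau> i \<longleftrightarrow> b < a" "\<pi> ! ?\<tau> k < \<pi> ! ?\<tau> i \<longleftrightarrow> c < a"
      "\<pi> ! ?\<tau> k < \<pi> ! ?\<tau> j \<longleftrightarrow> c < b"
    using o ijk by (simp_all add: nth_swap_adjacent len)
  show ?thesis
  proof (cases "i = 0 \<and> j = Suc 0")
    case True
    then have "\<pi> ! i \<noteq> \<pi> ! j"
      using \<pi> ijk by (simp add: symm_iff nth_eq_iff_index_eq len)
    moreover have "?\<tau> i = j" "?\<tau> j = i" "?\<tau> k = k"
      using True ijk by (simp_all add: transpose_def)
    ultimately have "(\<pi> ! j < \<pi> ! i \<longleftrightarrow> a < b) \<and> (\<pi> ! k < \<pi> ! i \<longleftrightarrow> c < b) \<and>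
        (\<pi> ! k < \<pi> ! j \<longleftrightarrow> c < a)"
      using o \<open>a \<noteq> b\<close> by simp linarith
    then have "contains_pattern \<pi> [b, a, c]"
      using ijk unfolding contains_pattern_length_3 len by blast
    then show ?thesis ..
  next
    case False
    moreover have "\<not> (j = 0 \<and> k = Suc 0)" "Suc 0 < n"
      using ijk by linarith+
    ultimately have "?\<tau> i < ?\<tau> j" "?\<tau> j < ?\<tau> k" "?\<tau> k < n"
      using ijk by (blast intro: transpose_Suc_less transpose_Suc_less_length)+
    then have "contains_pattern \<pi> [a, b, c]"
      using o unfolding contains_pattern_length_3 len by blast
    then show ?thesis ..
  qed
qed

text \<open>Read contrapositively, \<open>closed\<close> says that the exchange maps avoiders to
  avoiders. It allows \<open>\<sigma>'\<close> to differ from \<open>\<sigma>\<close>, because an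
  exchange may turn one pattern of \<open>\<Sigma>\<close> into another.\<close>

lemma avoiders_swap_adjacent_balanced:
  assumes p: "Suc p < n"
    and closed: "\<And>\<pi> \<sigma>. \<pi> \<in> symm n \<Longrightarrow> \<sigma> \<in> \<Sigma> \<Longrightarrow> contains_pattern (swap_adjacent p \<pi>) \<sigma> \<Longrightarrow>
      \<exists>\<sigma>' \<in> \<Sigma>. contains_pattern \<pi> \<sigma>'"
  shows "sign_balanced (avoiders n \<Sigma>)"
proof (rule sign_balanced_involution)
  show "finite (avoiders n \<Sigma>)"
    using finite_symm by (simp add: avoiders_def)
  fix \<pi> assume "\<pi> \<in> avoiders n \<Sigma>"
  then have \<pi>: "\<pi> \<in> symm n" and av: "\<And>\<sigma>. \<sigma> \<in> \<Sigma> \<Longrightarrow> \<not> contains_pattern \<pi> \<sigma>"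
    by (auto simp: avoiders_def)
  show "swap_adjacent p \<pi> \<in> avoiders n \<Sigma>"
    using closed[OF \<pi>] av swap_adjacent_symm[OF \<pi> p] by (auto simp: avoiders_def)
  show "swap_adjacent p (swap_adjacent p \<pi>) = \<pi>"
    using p by (simp add: swap_adjacent_idem length_symm[OF \<pi>])
  show "even_perm (swap_adjacent p \<pi>) \<longleftrightarrow> \<not> even_perm \<pi>"
    using p \<pi> by (simp add: even_perm_swap_adjacent length_symm[OF \<pi>] symm_iff)
qed

lemma avoiders_swap_values_balanced:
  assumes a: "1 \<le> a" "a < n"
    and closed: "\<And>\<pi> \<sigma>. \<pi> \<in> symm n \<Longrightarrow> \<sigma> \<in> \<Sigma> \<Longrightarrow>
      contains_pattern (map (transpose a (Suc a)) \<pi>) \<sigma> \<Longrightarrow> \<exists>\<sigma>' \<in> \<Sigma>. contains_pattern \<pi> \<sigma>'"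
  shows "sign_balanced (avoiders n \<Sigma>)"
proof (rule sign_balanced_involution)
  let ?\<tau> = "transpose a (Suc a)"
  show "finite (avoiders n \<Sigma>)"
    using finite_symm by (simp add: avoiders_def)
  fix \<pi> assume "\<pi> \<in> avoiders n \<Sigma>"
  then have \<pi>: "\<pi> \<in> symm n" and av: "\<And>\<sigma>. \<sigma> \<in> \<Sigma> \<Longrightarrow> \<not> contains_pattern \<pi> \<sigma>"
    by (auto simp: avoiders_def)
  show "map ?\<tau> \<pi> \<in> avoiders n \<Sigma>"
    using closed[OF \<pi>] av swap_values_symm[OF \<pi> a] by (auto simp: avoiders_def)
  show "map ?\<tau> (map ?\<tau> \<pi>) = \<pi>"
    by (simp add: o_def)
  show "even_perm (map ?\<tau> \<pi>) \<longleftrightarrow> \<not> even_perm \<pi>"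
    by (rule even_perm_swap_values[OF \<pi> a])
qed

lemma balanced_closed_last:
  assumes "\<Sigma> \<subseteq> symm 3" "n > 1" and closed: "\<And>a b c. [a, b, c] \<in> \<Sigma> \<Longrightarrow> [a, c, b] \<in> \<Sigma>"
  shows "sign_balanced (avoiders n \<Sigma>)"
\<comment> \<open>Counting from 0, the last two entries stand at \<open>n - 2\<close> and
  \<open>n - 1\<close>.\<close>
proof (rule avoiders_swap_adjacent_balanced[where p = "n - 2"])
  fix \<pi> \<sigma>
  assume *: "\<pi> \<in> symm n" "\<sigma> \<in> \<Sigma>" "contains_pattern (swap_adjacent (n - 2) \<pi>) \<sigma>"
  from * obtain a b c where "\<sigma> = [a, b, c]" "b \<noteq> c"
    using symm_3_E assms(1) by (metis subsetD)
  then show "\<exists>\<sigma>' \<in> \<Sigma>. contains_pattern \<pi> \<sigma>'"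
    using contains_pattern_swap_last[of n \<pi> a b c] * closed by blast
qed (use assms in simp)

lemma balanced_closed_first:
  assumes "\<Sigma> \<subseteq> symm 3" "n > 1" and closed: "\<And>a b c. [a, b, c] \<in> \<Sigma> \<Longrightarrow> [b, a, c] \<in> \<Sigma>"
  shows "sign_balanced (avoiders n \<Sigma>)"
proof (rule avoiders_swap_adjacent_balanced[where p = 0])
  fix \<pi> \<sigma>
  assume *: "\<pi> \<in> symm n" "\<sigma> \<in> \<Sigma>" "contains_pattern (swap_adjacent 0 \<pi>) \<sigma>"
  from * obtain a b c where "\<sigma> = [a, b, c]" "a \<noteq> b"
    using symm_3_E assms(1) by (metis subsetD)
  then show "\<exists>\<sigma>' \<in> \<Sigma>. contains_pattern \<pi> \<sigma>'"
    using contains_pattern_swap_first[of \<pi> a b c n] * closed by blast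
qed (use assms in simp)

section \<open>Peaks, valleys and monotone triples\<close>

lemma contains_peak:
  assumes "\<pi> \<in> symm n"
  shows "contains_pattern \<pi> [1,3,2] \<or> contains_pattern \<pi> [2,3,1] \<longleftrightarrow>
    (\<exists>i j k. i < j \<and> j < k \<and> k < length \<pi> \<and> \<pi> ! i < \<pi> ! j \<and> \<pi> ! k < \<pi> ! j)"
  (is "?L \<longleftrightarrow> ?R")
proof -
  \<comment> \<open>For an ascent a pattern only records that there is no descent; distinct entries
    make it strict.\<close>
  have ne: "\<pi> ! i \<noteq> \<pi> ! j" if "i < j" "j < length \<pi>" for i j
    using assms that by (simp add: symm_iff nth_eq_iff_index_eq)
  show ?thesis
  proof
    assume ?L
    then obtain i j k where "i < j" "j < k" "k < length \<pi>" "\<not> \<pi> ! j < \<pi> ! i" "\<pi> ! k < \<pi> ! j"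
      by (auto simp: contains_pattern_length_3)
    then show ?R
      using ne[of i j] by (metis less_trans linorder_less_linear)
  next
    assume ?R
    then obtain i j k where "i < j" "j < k" "k < length \<pi>" "\<pi> ! i < \<pi> ! j" "\<pi> ! k < \<pi> ! j"
      by blast
    \<comment> \<open>The two patterns differ only in the order of the outer entries, which selects
      the one that occurs.\<close>
    then have "contains_pattern \<pi> (if \<pi> ! k < \<pi> ! i then [2,3,1] else [1,3,2])"
      by (cases "\<pi> ! k < \<pi> ! i"; simp only: if_True if_False contains_pattern_length_3;
          intro exI[of _ i] exI[of _ j] exI[of _ k]) auto
    then show ?L
      by (auto split: if_splits)
  qed
qed

lemma contains_valley:
  assumes "\<pi> \<in> symm n"
  shows "contains_pattern \<pi> [2,1,3] \<or> contains_pattern \<pi> [3,1,2] \<longleftrightarrow>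
    (\<exists>i j k. i < j \<and> j < k \<and> k < length \<pi> \<and> \<pi> ! j < \<pi> ! i \<and> \<pi> ! j < \<pi> ! k)"
  (is "?L \<longleftrightarrow> ?R")
proof -
  have ne: "\<pi> ! i \<noteq> \<pi> ! j" if "i < j" "j < length \<pi>" for i j
    using assms that by (simp add: symm_iff nth_eq_iff_index_eq)
  show ?thesis
  proof
    assume ?L
    then obtain i j k where "i < j" "j < k" "k < length \<pi>" "\<pi> ! j < \<pi> ! i" "\<not> \<pi> ! k < \<pi> ! j"
      by (auto simp: contains_pattern_length_3)
    then show ?R
      using ne[of j k] by (metis linorder_less_linear)
  next
    assume ?R
    then obtain i j k where "i < j" "j < k" "k < length \<pi>" "\<pi> ! j < \<pi> ! i" "\<pi> ! j < \<pi> ! k"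
      by blast
    then have "contains_pattern \<pi> (if \<pi> ! k < \<pi> ! i then [3,1,2] else [2,1,3])"
      by (cases "\<pi> ! k < \<pi> ! i"; simp only: if_True if_False contains_pattern_length_3;
          intro exI[of _ i] exI[of _ j] exI[of _ k]) auto
    then show ?L
      by (auto split: if_splits)
  qed
qed

text \<open>The top of a peak exceeds two distinct positive values, so it is at least 3 and stays
  fixed. Both 1 and 2 lie below it, and exchanging them changes no comparison with it.\<close>

lemma transpose_bottom_peak:
  fixes x y z :: nat
  assumes "x \<noteq> z" "1 \<le> x" "1 \<le> y" "1 \<le> z"
    and peak: "transpose 1 (Suc 1) x < transpose 1 (Suc 1) y"
      "transpose 1 (Suc 1) z < transpose 1 (Suc 1) y"
  shows "x < y \<and> z < y"
proof -
  let ?\<tau> = "transpose 1 (Suc 1)"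
  have "y > 2"
  proof (rule ccontr)
    assume "\<not> y > 2"
    then have "?\<tau> y \<le> 2"
      by (simp add: transpose_def)
    moreover have "?\<tau> x \<ge> 1" "?\<tau> z \<ge> 1" "?\<tau> x \<noteq> ?\<tau> z"
      using assms(1-4) by (simp_all add: transpose_def)
    ultimately show False
      using peak by linarith
  qed
  then have "?\<tau> y = y" "?\<tau> w < y \<longleftrightarrow> w < y" for w
    by (auto simp: transpose_def)
  then show ?thesis
    using peak by simp
qed

text \<open>Dually, the bottom of a valley lies below two distinct values that are at most
  \<open>Suc a\<close>. Hence it is below \<open>a\<close>, stays fixed, and remains below both
  exchanged values.\<close>

lemma transpose_top_valley:
  fixes x y z :: nat
  assumes "x \<noteq> z" "x \<le> Suc a" "y \<le> Suc a" "z \<le> Suc a"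
    and valley: "transpose a (Suc a) y < transpose a (Suc a) x"
      "transpose a (Suc a) y < transpose a (Suc a) z"
  shows "y < x \<and> y < z"
proof -
  let ?\<tau> = "transpose a (Suc a)"
  have "y < a"
  proof (rule ccontr)
    assume "\<not> y < a"
    then have "?\<tau> y \<ge> a"
      by (simp add: transpose_def)
    moreover have "?\<tau> x \<le> Suc a" "?\<tau> z \<le> Suc a" "?\<tau> x \<noteq> ?\<tau> z"
      using assms(1-4) by (simp_all add: transpose_def)
    ultimately show False
      using valley by linarith
  qed
  then have "?\<tau> y = y" "y < ?\<tau> w \<longleftrightarrow> y < w" for w
    by (auto simp: transpose_def)
  then show ?thesis
    using valley by simp
qed

text \<open>The two patterns have to be treated together: exchanging the values 1 and 2 can turn an
  occurrence of 132 into one of 231, but it remains a peak.\<close>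

lemma balanced_no_peak:
  assumes "n > 1"
  shows "sign_balanced (avoiders n {[1,3,2], [2,3,1]})"
proof (rule avoiders_swap_values_balanced[where a = 1])
  let ?\<tau> = "transpose 1 (Suc 1)"
  fix \<pi> \<sigma>
  assume \<pi>: "\<pi> \<in> symm n" and \<sigma>: "\<sigma> \<in> {[1,3,2], [2,3,1]}" "contains_pattern (map ?\<tau> \<pi>) \<sigma>"
  have \<tau>\<pi>: "map ?\<tau> \<pi> \<in> symm n"
    using swap_values_symm[OF \<pi>] assms by simp
  from \<sigma> obtain i j k where ijk: "i < j" "j < k" "k < length \<pi>"
    and peak: "?\<tau> (\<pi> ! i) < ?\<tau> (\<pi> ! j)" "?\<tau> (\<pi> ! k) < ?\<tau> (\<pi> ! j)"
    using contains_peak[OF \<tau>\<pi>] by auto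
  have "\<pi> ! i \<noteq> \<pi> ! k"
    using \<pi> ijk by (simp add: symm_iff nth_eq_iff_index_eq)
  moreover have "1 \<le> \<pi> ! i" "1 \<le> \<pi> ! j" "1 \<le> \<pi> ! k"
    using \<pi> ijk nth_mem[of _ \<pi>] by (auto simp: symm_iff)
  ultimately have "\<pi> ! i < \<pi> ! j" "\<pi> ! k < \<pi> ! j"
    using transpose_bottom_peak peak by blast+
  then show "\<exists>\<sigma>' \<in> {[1,3,2], [2,3,1]}. contains_pattern \<pi> \<sigma>'"
    using contains_peak[OF \<pi>] ijk by blast
qed (use assms in simp_all)

lemma balanced_no_valley:
  assumes "n > 1"
  shows "sign_balanced (avoiders n {[2,1,3], [3,1,2]})"
proof -
  \<comment> \<open>The two largest values are \<open>a\<close> and \<open>Suc a\<close>; the name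
    avoids truncated subtraction.\<close>
  define a where "a = n - 1"
  have a: "1 \<le> a" "n = Suc a"
    using assms by (simp_all add: a_def)
  show ?thesis
  proof (rule avoiders_swap_values_balanced)
    let ?\<tau> = "transpose a (Suc a)"
    fix \<pi> \<sigma>
    assume \<pi>: "\<pi> \<in> symm n" and \<sigma>: "\<sigma> \<in> {[2,1,3], [3,1,2]}" "contains_pattern (map ?\<tau> \<pi>) \<sigma>"
    have \<tau>\<pi>: "map ?\<tau> \<pi> \<in> symm n"
      using swap_values_symm[OF \<pi>] a by simp
    from \<sigma> obtain i j k where ijk: "i < j" "j < k" "k < length \<pi>"
      and valley: "?\<tau> (\<pi> ! j) < ?\<tau> (\<pi> ! i)" "?\<tau> (\<pi> ! j) < ?\<tau> (\<pi> ! k)"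
      using contains_valley[OF \<tau>\<pi>] by auto
    have "\<pi> ! i \<noteq> \<pi> ! k"
      using \<pi> ijk by (simp add: symm_iff nth_eq_iff_index_eq)
    moreover have "\<pi> ! i \<le> Suc a" "\<pi> ! j \<le> Suc a" "\<pi> ! k \<le> Suc a"
      using \<pi> ijk a nth_mem[of _ \<pi>] by (auto simp: symm_iff)
    ultimately have "\<pi> ! j < \<pi> ! i" "\<pi> ! j < \<pi> ! k"
      using transpose_top_valley valley by blast+
    then show "\<exists>\<sigma>' \<in> {[2,1,3], [3,1,2]}. contains_pattern \<pi> \<sigma>'"
      using contains_valley[OF \<pi>] ijk by blast
  qed (use a in simp_all)
qed

text \<open>The Erdos-Szekeres bound for monotone triples. Without such a triple, each comparison of
  \<open>j\<close> with an earlier position is opposite to each comparison of \<open>j\<close> with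
  a later one.\<close>

lemma contains_monotone:
  assumes "\<pi> \<in> symm n" "n \<ge> 5"
  shows "contains_pattern \<pi> [1,2,3] \<or> contains_pattern \<pi> [3,2,1]"
proof (rule ccontr)
  assume none: "\<not> ?thesis"
  have alternate: "\<pi> ! k < \<pi> ! j \<longleftrightarrow> \<not> \<pi> ! j < \<pi> ! i" if ijk: "i < j" "j < k" "k < n" for i j k
  proof (rule ccontr)
    assume "\<not> ?thesis"
    \<comment> \<open>If both comparisons at \<open>j\<close> agree, transitivity settles the outer
      one.\<close>
    then have "(\<pi> ! j < \<pi> ! i \<and> \<pi> ! k < \<pi> ! i \<and> \<pi> ! k < \<pi> ! j) \<or>
        (\<not> \<pi> ! j < \<pi> ! i \<and> \<not> \<pi> ! k < \<pi> ! i \<and> \<not> \<pi> ! k < \<pi> ! j)"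
      by linarith
    then have "contains_pattern \<pi> (if \<pi> ! j < \<pi> ! i then [3,2,1] else [1,2,3])"
      using ijk length_symm[OF assms(1)]
      by (cases "\<pi> ! j < \<pi> ! i"; simp only: if_True if_False contains_pattern_length_3;
          intro exI[of _ i] exI[of _ j] exI[of _ k]) auto
    with none show False
      by (auto split: if_splits)
  qed
  show False
    \<comment> \<open>If positions 0, 1 form a descent, then 1, 2 and 1, 3 are ascents and 2, 3 is a
      descent. Now 3, 4 must be a descent because of 1, 3 and an ascent because of 2, 3. The other
      case is symmetric.\<close>
    using alternate[of 0 1 2] alternate[of 1 2 3] alternate[of 0 1 3] alternate[of 1 3 4]
      alternate[of 2 3 4] assms(2) by simp
qed

section \<open>Parity and containment computed for lengths up to four\<close>

lemma even_perm_Nil [simp]: "even_perm []"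
  by (simp add: even_perm_def inversions_def)

text \<open>Inversions either start at position 0, one for each smaller later entry, or are those of
  the tail shifted by one. As a simplification rule this computes the parity of concrete
  lists.\<close>

lemma even_perm_Cons [simp]:
  "even_perm (x # xs) \<longleftrightarrow> (even (length (filter (\<lambda>y. y < x) xs)) \<longleftrightarrow> even_perm xs)"
proof -
  let ?A = "(\<lambda>j. (0 :: nat, Suc j)) ` {j. j < length xs \<and> xs ! j < x}"
  let ?B = "map_prod Suc Suc ` inversions xs"
  have "inversions (x # xs) = ?A \<union> ?B"
  proof (intro set_eqI iffI)
    fix z assume "z \<in> inversions (x # xs)"
    then obtain i j where "z = (i, j)" "i < j" "j < length (x # xs)" "(x # xs) ! j < (x # xs) ! i"
      by (auto simp: inversions_def)
    then show "z \<in> ?A \<union> ?B"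
      by (cases i; cases j) (auto simp: inversions_def)
  qed (auto simp: inversions_def)
  moreover have "card ?A = length (filter (\<lambda>y. y < x) xs)"
    by (subst card_image) (auto simp: inj_on_def length_filter_conv_card)
  moreover have "card ?B = card (inversions xs)"
    by (intro card_image) (simp add: prod.inj_map inj_on_subset[OF prod.inj_map])
  moreover have "card (?A \<union> ?B) = card ?A + card ?B"
    by (rule card_Un_disjoint) (auto simp: finite_inversions)
  ultimately show ?thesis
    by (auto simp: even_perm_def)
qed

lemma even_perm_symm_3:
  assumes "\<pi> \<in> symm 3"
  shows "even_perm \<pi> \<longleftrightarrow> \<pi> \<in> {[1,2,3], [2,3,1], [3,1,2]}"
    and "odd_perm \<pi> \<longleftrightarrow> \<pi> \<in> {[1,3,2], [2,1,3], [3,2,1]}"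
proof -
  have "odd_perm \<pi> \<longleftrightarrow> \<not> even_perm \<pi>"
    by (simp add: odd_perm_def even_perm_def)
  with assms show "even_perm \<pi> \<longleftrightarrow> \<pi> \<in> {[1,2,3], [2,3,1], [3,1,2]}"
      "odd_perm \<pi> \<longleftrightarrow> \<pi> \<in> {[1,3,2], [2,1,3], [3,2,1]}"
    unfolding symm_3 by (elim insertE emptyE; simp)+
qed

text \<open>Balance becomes an equation in six membership bits, three for the even and three for the
  odd permutations, ready for case analysis.\<close>

lemma sign_balanced_subset_symm_3:
  assumes "\<Sigma> \<subseteq> symm 3"
  shows "sign_balanced \<Sigma> \<longleftrightarrow>
    of_bool ([1,2,3] \<in> \<Sigma>) + of_bool ([2,3,1] \<in> \<Sigma>) + of_bool ([3,1,2] \<in> \<Sigma>) =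
    of_bool ([1,3,2] \<in> \<Sigma>) + of_bool ([2,1,3] \<in> \<Sigma>) + (of_bool ([3,2,1] \<in> \<Sigma>) :: nat)"
proof -
  have "\<pi> \<in> \<Sigma> \<and> even_perm \<pi> \<longleftrightarrow> \<pi> \<in> \<Sigma> \<and> \<pi> \<in> {[1,2,3], [2,3,1], [3,1,2]}"
      "\<pi> \<in> \<Sigma> \<and> odd_perm \<pi> \<longleftrightarrow> \<pi> \<in> \<Sigma> \<and> \<pi> \<in> {[1,3,2], [2,1,3], [3,2,1]}" for \<pi>
    using assms even_perm_symm_3[of \<pi>] by (metis subsetD)+
  then have "{\<pi> \<in> \<Sigma>. even_perm \<pi>} = \<Sigma> \<inter> {[1,2,3], [2,3,1], [3,1,2]}"
      "{\<pi> \<in> \<Sigma>. odd_perm \<pi>} = \<Sigma> \<inter> {[1,3,2], [2,1,3], [3,2,1]}"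
    unfolding Int_def by (simp_all only:)
  moreover have "card (\<Sigma> \<inter> {x, y, z}) =
      of_bool (x \<in> \<Sigma>) + of_bool (y \<in> \<Sigma>) + of_bool (z \<in> \<Sigma>)"
    if "distinct [x, y, z]" for x y z
    using that by (simp add: Int_insert_right)
  ultimately show ?thesis
    unfolding sign_balanced_def by simp
qed

text \<open>Listing the increasing triples makes containment in a concrete list free of quantifiers;
  the next lemma does the same for length 4.\<close>

lemma ex_triple_less_3:
  "(\<exists>i j k. i < j \<and> j < k \<and> k < (3 :: nat) \<and> P i j k) \<longleftrightarrow> P 0 1 2" (is "?L \<longleftrightarrow> ?R")
proof
  assume ?L
  then obtain i j k where ijk: "i < j" "j < k" "k < 3" "P i j k" by blast
  then have "i = 0" "j = 1" "k = 2" by linarith+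
  with ijk show ?R by simp
next
  assume ?R
  then show ?L
    by (intro exI conjI) simp_all
qed

lemma ex_triple_less_4:
  "(\<exists>i j k. i < j \<and> j < k \<and> k < (4 :: nat) \<and> P i j k) \<longleftrightarrow>
    P 0 1 2 \<or> P 0 1 3 \<or> P 0 2 3 \<or> P 1 2 3" (is "?L \<longleftrightarrow> ?R")
proof
  assume ?L
  then obtain i j k where ijk: "i < j" "j < k" "k < 4" "P i j k" by blast
  then have "i = 0 \<and> j = 1 \<and> k = 2 \<or> i = 0 \<and> j = 1 \<and> k = 3 \<or> i = 0 \<and> j = 2 \<and> k = 3 \<or>
      i = 1 \<and> j = 2 \<and> k = 3"
    by linarith
  with ijk show ?R by blast
next
  have I: ?L if "P i j k" "i < j" "j < k" "k < 4" for i j k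
    using that by blast
  assume ?R
  then show ?L
    by (elim disjE) (erule I; simp)+
qed

text \<open>With 0, 1, 2 as the only triple of positions, containment between members of
  \<open>symm 3\<close> is equality.\<close>

lemma avoiders_3:
  assumes "\<Sigma> \<subseteq> symm 3"
  shows "avoiders 3 \<Sigma> = symm 3 - \<Sigma>"
proof -
  have "contains_pattern [x, y, z] [a, b, c] \<longleftrightarrow>
      (y < x \<longleftrightarrow> b < a) \<and> (z < x \<longleftrightarrow> c < a) \<and> (z < y \<longleftrightarrow> c < b)" for x y z a b c
  proof -
    \<comment> \<open>As a premise this rewrites the index bound to the literal 3 that
      \<open>ex_triple_less_3\<close> expects.\<close>
    have "length [x, y, z] = 3"
      by simp
    then show ?thesis
      unfolding contains_pattern_length_3 by (simp only: ex_triple_less_3) simp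
  qed
  then have "contains_pattern \<pi> \<sigma> \<longleftrightarrow> \<pi> = \<sigma>" if "\<pi> \<in> symm 3" "\<sigma> \<in> symm 3" for \<pi> \<sigma>
    using that unfolding symm_3 by (elim insertE emptyE; simp)
  then show ?thesis
    using assms by (auto simp: avoiders_def)
qed

text \<open>\<open>symm 3\<close> has three even and three odd members, so a subset is balanced
  exactly when its complement is.\<close>

lemma sign_balanced_avoiders_3:
  assumes "\<Sigma> \<subseteq> symm 3"
  shows "sign_balanced (avoiders 3 \<Sigma>) \<longleftrightarrow> sign_balanced \<Sigma>"
proof -
  have "\<sigma> \<in> symm 3 - \<Sigma> \<longleftrightarrow> \<sigma> \<notin> \<Sigma>" if "\<sigma> \<in> symm 3" for \<sigma>
    using that by simp
  then show ?thesis
    unfolding avoiders_3[OF assms] sign_balanced_subset_symm_3[OF assms]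
      sign_balanced_subset_symm_3[OF Diff_subset]
    by (simp add: symm_3 of_bool_not_iff)
qed

lemma symm_4: "symm 4 = {[1,2,3,4], [1,2,4,3], [1,3,2,4], [1,3,4,2], [1,4,2,3], [1,4,3,2],
    [2,1,3,4], [2,1,4,3], [2,3,1,4], [2,3,4,1], [2,4,1,3], [2,4,3,1],
    [3,1,2,4], [3,1,4,2], [3,2,1,4], [3,2,4,1], [3,4,1,2], [3,4,2,1],
    [4,1,2,3], [4,1,3,2], [4,2,1,3], [4,2,3,1], [4,3,1,2], [4,3,2,1]}"
proof -
  have "{1..4} = set [1, 2, 3, 4 :: nat]" by auto
  then show ?thesis
    unfolding symm_def by (simp only:) code_simp
qed

lemma contains_pattern_4:
  "contains_pattern [w, x, y, z] [a, b, c] \<longleftrightarrow>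
    (x < w \<longleftrightarrow> b < a) \<and> (y < w \<longleftrightarrow> c < a) \<and> (y < x \<longleftrightarrow> c < b) \<or>
    (x < w \<longleftrightarrow> b < a) \<and> (z < w \<longleftrightarrow> c < a) \<and> (z < x \<longleftrightarrow> c < b) \<or>
    (y < w \<longleftrightarrow> b < a) \<and> (z < w \<longleftrightarrow> c < a) \<and> (z < y \<longleftrightarrow> c < b) \<or>
    (y < x \<longleftrightarrow> b < a) \<and> (z < x \<longleftrightarrow> c < a) \<and> (z < y \<longleftrightarrow> c < b)"
proof -
  have "length [w, x, y, z] = 4"
    by simp
  then show ?thesis
    unfolding contains_pattern_length_3 by (simp only: ex_triple_less_4) simp
qed

text \<open>Filters an explicitly listed set one element at a time.\<close>

lemma Collect_mem_insert_conj:
  "{x \<in> insert a A. P x} = (if P a then {a} else {}) \<union> {x \<in> A. P x}"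
  by auto

lemma avoiders_4_monotone:
  "avoiders 4 {[1,2,3], [3,2,1]} = {[2,1,4,3], [2,4,1,3], [3,1,4,2], [3,4,1,2]}"
  unfolding avoiders_def symm_4 Collect_mem_insert_conj by (simp add: contains_pattern_4 insert_commute)

lemma avoiders_4_exceptional:
  "avoiders 4 {[1,3,2], [2,1,3], [2,3,1], [3,1,2]} = {[1,2,3,4], [4,3,2,1]}"
  unfolding avoiders_def symm_4 Collect_mem_insert_conj by (simp add: contains_pattern_4 insert_commute)

lemma sign_balanced_avoiders_4_monotone: "sign_balanced (avoiders 4 {[1,2,3], [3,2,1]})"
  unfolding sign_balanced_def avoiders_4_monotone Collect_mem_insert_conj
  \<comment> \<open>Folding to \<open>even_perm\<close> lets the rule \<open>even_perm_Cons\<close>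
    decide oddness as well.\<close>
  by (simp add: odd_perm_def flip: even_perm_def)

lemma not_sign_balanced_avoiders_4_exceptional:
  "\<not> sign_balanced (avoiders 4 {[1,3,2], [2,1,3], [2,3,1], [3,1,2]})"
  unfolding sign_balanced_def avoiders_4_exceptional Collect_mem_insert_conj
  by (simp add: odd_perm_def flip: even_perm_def)

text \<open>Two entries leave no room for a pattern of length three, so the closure condition holds
  vacuously.\<close>

lemma sign_balanced_avoiders_2:
  assumes "\<Sigma> \<subseteq> symm 3"
  shows "sign_balanced (avoiders 2 \<Sigma>)"
proof (rule avoiders_swap_adjacent_balanced[where p = 0])
  fix \<pi> \<sigma>
  assume *: "\<pi> \<in> symm 2" "\<sigma> \<in> \<Sigma>" "contains_pattern (swap_adjacent 0 \<pi>) \<sigma>"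
  from * obtain a b c where "\<sigma> = [a, b, c]"
    using symm_3_E assms by (metis subsetD)
  then show "\<exists>\<sigma>' \<in> \<Sigma>. contains_pattern \<pi> \<sigma>'"
    using * by (auto simp: contains_pattern_length_3 length_symm)
qed simp

section \<open>Sets with both monotone patterns, and the final case analysis\<close>

lemma balanced_monotone_patterns:
  assumes \<Sigma>: "\<Sigma> \<subseteq> symm 3" and "n > 1" and bal: "sign_balanced \<Sigma>"
    and mono: "[1,2,3] \<in> \<Sigma>" "[3,2,1] \<in> \<Sigma>"
  shows "sign_balanced (avoiders n \<Sigma>)"
proof -
  consider "n \<ge> 5" | "n = 2" | "n = 3" | "n = 4"
    using \<open>n > 1\<close> by linarith
  then show ?thesis
  proof cases
    case 1
    then have "avoiders n \<Sigma> = {}"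
      using contains_monotone mono by (auto simp: avoiders_def)
    then show ?thesis
      by (simp add: sign_balanced_def)
  next
    case 2
    then show ?thesis
      using sign_balanced_avoiders_2[OF \<Sigma>] by simp
  next
    case 3
    then show ?thesis
      using sign_balanced_avoiders_3[OF \<Sigma>] bal by simp
  next
    case 4
    \<comment> \<open>Of the monotone patterns 123 is even and 321 is odd, so they cancel.\<close>
    have counts: "of_bool ([2,3,1] \<in> \<Sigma>) + of_bool ([3,1,2] \<in> \<Sigma>) =
        of_bool ([1,3,2] \<in> \<Sigma>) + (of_bool ([2,1,3] \<in> \<Sigma>) :: nat)"
      using bal mono unfolding sign_balanced_subset_symm_3[OF \<Sigma>] by simp
    show ?thesis
    proof (cases "[2,3,1] \<in> \<Sigma> \<or> [3,1,2] \<in> \<Sigma>")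
      case True
      then have ex: "[2,3,1] \<in> \<Sigma> \<or> [3,1,2] \<in> \<Sigma>" "[1,3,2] \<in> \<Sigma> \<or> [2,1,3] \<in> \<Sigma>"
        using counts by (auto simp: of_bool_def split: if_splits)
      have sub: "avoiders 4 \<Sigma> \<subseteq> avoiders 4 {[1,2,3], [3,2,1]}"
        using mono by (auto simp: avoiders_def)
      \<comment> \<open>Each of the four candidates contains both even or both odd non-monotone
        patterns. By \<open>ex\<close>, \<open>\<Sigma>\<close> has one of each parity, which
        excludes all four.\<close>
      have "\<exists>\<sigma> \<in> \<Sigma>. contains_pattern \<pi> \<sigma>" if "\<pi> \<in> avoiders 4 {[1,2,3], [3,2,1]}" for \<pi>
      proof -
        have "contains_pattern \<pi> [2,3,1] \<and> contains_pattern \<pi> [3,1,2] \<or>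
            contains_pattern \<pi> [1,3,2] \<and> contains_pattern \<pi> [2,1,3]"
          using that unfolding avoiders_4_monotone
          by (elim insertE emptyE; simp add: contains_pattern_4)
        then show ?thesis
          using ex by blast
      qed
      then have "avoiders 4 \<Sigma> = {}"
        using sub by (auto simp: avoiders_def)
      then show ?thesis
        by (simp add: sign_balanced_def 4)
    next
      case False
      then have "[1,3,2] \<notin> \<Sigma>" "[2,1,3] \<notin> \<Sigma>"
        using counts by (simp_all add: of_bool_def split: if_splits)
      then have "\<Sigma> = {[1,2,3], [3,2,1]}"
        using \<Sigma> False mono unfolding symm_3 by blast
      then show ?thesis
        using sign_balanced_avoiders_4_monotone 4 by simp
    qed
  qed
qed

theorem theorem1p2:
  fixes \<sigma>s :: "nat list list"
  assumes "distinct \<sigma>s"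
    and "set \<sigma>s \<subseteq> symm 3"
  shows "(\<forall>n > 1. sign_balanced (avoiders n (set \<sigma>s))) \<longleftrightarrow>
    set \<sigma>s \<noteq> {[1, 3, 2], [2, 1, 3], [2, 3, 1], [3, 1, 2]} \<and> sign_balanced (set \<sigma>s)"
proof
  assume all: "\<forall>n > 1. sign_balanced (avoiders n (set \<sigma>s))"
  have "sign_balanced (avoiders 4 (set \<sigma>s))" "sign_balanced (avoiders 3 (set \<sigma>s))"
    using all by simp_all
  then show "set \<sigma>s \<noteq> {[1, 3, 2], [2, 1, 3], [2, 3, 1], [3, 1, 2]} \<and> sign_balanced (set \<sigma>s)"
    using not_sign_balanced_avoiders_4_exceptional sign_balanced_avoiders_3[OF assms(2)] by metis
next
  let ?\<Sigma> = "set \<sigma>s"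
  assume "?\<Sigma> \<noteq> {[1, 3, 2], [2, 1, 3], [2, 3, 1], [3, 1, 2]} \<and> sign_balanced ?\<Sigma>"
  then have exceptional: "?\<Sigma> \<noteq> {[1,3,2], [2,1,3], [2,3,1], [3,1,2]}" and bal: "sign_balanced ?\<Sigma>"
    by auto
  \<comment> \<open>Equality with an explicit set is reduced to the same six membership bits that
    express balance.\<close>
  have eq_iff: "?\<Sigma> = T \<longleftrightarrow> (\<forall>\<sigma> \<in> symm 3. \<sigma> \<in> ?\<Sigma> \<longleftrightarrow> \<sigma> \<in> T)" if "T \<subseteq> symm 3" for T
    using that assms(2) by blast
  have "{[1,3,2], [2,1,3], [2,3,1], [3,1,2]} \<subseteq> symm 3" "{[1,3,2], [2,3,1]} \<subseteq> symm 3"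
      "{[2,1,3], [3,1,2]} \<subseteq> symm 3"
    by (simp_all add: symm_3)
  note eqs = this[THEN eq_iff]
  \<comment> \<open>The equivalences pair patterns that differ by exchanging their last,
    respectively first, two entries. The cases may overlap; the only balanced set outside all of
    them is the exceptional one.\<close>
  consider
      (last) "[1,2,3] \<in> ?\<Sigma> \<longleftrightarrow> [1,3,2] \<in> ?\<Sigma>" "[2,1,3] \<in> ?\<Sigma> \<longleftrightarrow> [2,3,1] \<in> ?\<Sigma>"
        "[3,1,2] \<in> ?\<Sigma> \<longleftrightarrow> [3,2,1] \<in> ?\<Sigma>"
    | (first) "[1,2,3] \<in> ?\<Sigma> \<longleftrightarrow> [2,1,3] \<in> ?\<Sigma>" "[1,3,2] \<in> ?\<Sigma> \<longleftrightarrow> [3,1,2] \<in> ?\<Sigma>"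
        "[2,3,1] \<in> ?\<Sigma> \<longleftrightarrow> [3,2,1] \<in> ?\<Sigma>"
    | (peak) "?\<Sigma> = {[1,3,2], [2,3,1]}"
    | (valley) "?\<Sigma> = {[2,1,3], [3,1,2]}"
    | (monotone) "[1,2,3] \<in> ?\<Sigma>" "[3,2,1] \<in> ?\<Sigma>"
    \<comment> \<open>All 64 combinations of memberships are checked.\<close>
    using exceptional bal unfolding eqs sign_balanced_subset_symm_3[OF assms(2)]
    by (cases "[1,2,3] \<in> ?\<Sigma>"; cases "[1,3,2] \<in> ?\<Sigma>"; cases "[2,1,3] \<in> ?\<Sigma>";
        cases "[2,3,1] \<in> ?\<Sigma>"; cases "[3,1,2] \<in> ?\<Sigma>"; cases "[3,2,1] \<in> ?\<Sigma>";
        simp add: symm_3)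
  then show "\<forall>n > 1. sign_balanced (avoiders n ?\<Sigma>)"
  proof cases
    case last
    have "[a, c, b] \<in> ?\<Sigma>" if "[a, b, c] \<in> ?\<Sigma>" for a b c
    proof -
      have "[a, b, c] \<in> symm 3"
        using that assms(2) by blast
      then show ?thesis
        using that last unfolding symm_3 by (elim insertE emptyE; simp)
    qed
    then show ?thesis
      using balanced_closed_last[OF assms(2)] by simp
  next
    case first
    have "[b, a, c] \<in> ?\<Sigma>" if "[a, b, c] \<in> ?\<Sigma>" for a b c
    proof -
      have "[a, b, c] \<in> symm 3"
        using that assms(2) by blast
      then show ?thesis
        using that first unfolding symm_3 by (elim insertE emptyE; simp)
    qed
    then show ?thesis
      using balanced_closed_first[OF assms(2)] by simp
  next
    case peak
    then show ?thesis
      using balanced_no_peak by simp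
  next
    case valley
    then show ?thesis
      using balanced_no_valley by simp
  next
    case monotone
    then show ?thesis
      using balanced_monotone_patterns[OF assms(2) _ bal] by simp
  qed
qed

end
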